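(* Let $L=\bigoplus_{i=1}^{\infty}L_i$ be a thin Lie algebra with second diamond $L_k$, where $k>5$. Then there is a nonzero element $y$ of $L_1$ such that $[Lyy]=0$, that is, $[[a,y],y]=0$ for every $a\in L$.
   Context: Let $F$ be a field (of arbitrary characteristic). A thin Lie algebra over $F$ is a graded Lie algebra $L=\bigoplus_{i=1}^{\infty}L_i$ over $F$ (so $[L_i,L_j]\subseteq L_{i+j}$) with $\dim(L_1)=2$ and satisfying the covering property: for each $i\ge 1$, each nonzero $z\in L_i$ satisfies $[zL_1]=L_{i+1}$, where $[zL_1]=\{[z,a]:a\in L_1\}$. By convention, thin Lie algebras are required to be infinite-dimensional, and graded Lie algebras of maximal class are excluded, i.e. it is required that $\dim(L_i)=2$ for at least one $i>1$. All homogeneous components of a thin Lie algebra have dimension one or two; those of dimension two are called diamonds. Thus $L_1$ is a diamond, and the second diamond is $L_k$, where $k$ is the smallest integer $k>1$ with $\dim(L_k)=2$. Iterated Lie products are left-normed: $[abc]=[[a,b],c]$, and so on; $[Lyy]=0$ means $(\operatorname{ad} y)^2=0$. *)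

theory Defs
  imports Complex_Main
begin

locale lie_algebra = vector_space scale
  for scale :: "'f::field \<Rightarrow> 'a::ab_group_add \<Rightarrow> 'a" +
  fixes bracket :: "'a \<Rightarrow> 'a \<Rightarrow> 'a"
  assumes linear_bracket_left: "Vector_Spaces.linear scale scale (\<lambda>x. bracket x z)"
    and linear_bracket_right: "Vector_Spaces.linear scale scale (\<lambda>x. bracket z x)"
    and bracket_self: "bracket x x = 0"
    and jacobi: "bracket (bracket x y) z + bracket (bracket y z) x + bracket (bracket z x) y = 0"

(* The grading is by the positive integers only, so L 0 plays no role and is left unconstrained. *)
locale graded_lie_algebra = lie_algebra scale bracket
  for scale :: "'f::field \<Rightarrow> 'a::ab_group_add \<Rightarrow> 'a" and bracket +
  fixes L :: "nat \<Rightarrow> 'a set"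
  assumes subspace_component: "1 \<le> i \<Longrightarrow> subspace (L i)"
    and direct_sum: "\<exists>!f. (\<forall>i\<ge>1. f i \<in> L i) \<and> f 0 = 0 \<and> finite {i. f i \<noteq> 0} \<and>
          (\<Sum>i | f i \<noteq> 0. f i) = x"
    and bracket_component:
          "1 \<le> i \<Longrightarrow> 1 \<le> j \<Longrightarrow> x \<in> L i \<Longrightarrow> y \<in> L j \<Longrightarrow> bracket x y \<in> L (i + j)"

(* The covering property says nothing about L (i + 1) when L i is zero, so the standard
   requirement that every component has dimension one or two is an explicit axiom
   (dim_component).  It excludes, for instance, V semidirect M with V = L 1 a quadratic extension
   field K of the ground field, regarded as an abelian Lie algebra, and M = t^6 K[t] an abelian
   ideal on which v in V acts as multiplication by t v. There L 2, ..., L 5 vanish and all later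
   components are two-dimensional.  In the presence of covering, dim_component amounts to
   requiring that every L i with i >= 1 be nonzero. *)
locale thin_lie_algebra = graded_lie_algebra scale bracket L
  for scale :: "'f::field \<Rightarrow> 'a::ab_group_add \<Rightarrow> 'a" and bracket L +
  assumes dim_L1: "dim (L 1) = 2"
    and covering: "1 \<le> i \<Longrightarrow> z \<in> L i \<Longrightarrow> z \<noteq> 0 \<Longrightarrow> {bracket z a | a. a \<in> L 1} = L (i + 1)"
    and dim_component: "1 \<le> i \<Longrightarrow> dim (L i) = 1 \<or> dim (L i) = 2"
    and infinite_dimensional: "\<nexists>B. finite B \<and> span B = UNIV"
    and not_maximal_class: "\<exists>i>1. dim (L i) = 2"
begin

definition second_diamond :: nat
  where "second_diamond = (LEAST k. k > 1 \<and> dim (L k) = 2)"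

end

end

(* Write [abc...] for left-normed products, choose y in L_1 centralizing L_2, and choose x
   completing y to a basis of L_1. Since [yxy] = 0, every z satisfies
     [zxyy] = 2[zyxy] - [zyyx],
   so in characteristic two (ad y)^2 commutes with ad x, and [Lyy] = 0 by induction on the degree.
   Otherwise u = [yxxx] commutes with y as well: if not, then [uy] spans L_5, and computing
   [[yx],u] in two ways gives [uyx] = -[uyx], whence L_6 = 0.
   Suppose that [L_j y y] = 0 for all j < i but not for j = i. Every product [sW] in L_i, where s
   lies in L_(i-4) and the word W of length 4 in x and y involves y, is annihilated by (ad y)^2.
   By covering, a product [sW] with W of length at most 3 involving y therefore vanishes.
   Hence for nonzero s the product w = [sxxx] is nonzero, and [wxyy] = 2[wyxy]; but expanding
   [[sx],u,y] = [[sx],y,u] = 0 gives [wxyy] = 3[wyxy]. So [wxyy] = 0 = [wyyy], and then covering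
   yields [L_i y y] = 0. *)

theory Submission imports Defs
begin

section \<open>Linear algebra: doubling a vector, one-dimensional spaces\<close>

context vector_space
begin

lemma double_eq_0_iff:
  fixes v :: 'b
  assumes "(2::'a) \<noteq> 0"
  shows "v + v = 0 \<longleftrightarrow> v = 0"
proof -
  have "v + v = scale 2 v"
    by (metis one_add_one scale_left_distrib scale_one)
  then show ?thesis
    using assms by simp
qed

lemma double_eq_0:
  fixes v :: 'b
  assumes "(2::'a) = 0"
  shows "v + v = 0"
  by (metis assms one_add_one scale_left_distrib scale_one scale_zero_left)

lemma dim_1_multiple:
  assumes "dim V = 1" "w \<in> V" "w \<noteq> 0" "v \<in> V"
  obtains c where "v = scale c w"
proof -
  obtain B where B: "V \<subseteq> span B" "card B = 1"
    using basis_exists[of V] assms(1) by metis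
  obtain b where "B = {b}"
    using B(2) by (rule card_1_singletonE)
  with B(1) have "V \<subseteq> range (\<lambda>c. scale c b)"
    by (simp add: span_singleton)
  with assms(2,4) obtain c d where "v = scale c b" "w = scale d b"
    by (meson imageE subsetD)
  moreover from this have "d \<noteq> 0"
    using assms(3) by auto
  ultimately have "v = scale (c / d) w"
    by simp
  then show ?thesis ..
qed

end

section \<open>Consequences of the Jacobi identity in any Lie algebra\<close>

context lie_algebra
begin

notation bracket (infixl "\<bullet>" 70)

lemma bracket_linear_simps:
  "(a + b) \<bullet> c = a \<bullet> c + b \<bullet> c" "c \<bullet> (a + b) = c \<bullet> a + c \<bullet> b"
  "(a - b) \<bullet> c = a \<bullet> c - b \<bullet> c" "c \<bullet> (a - b) = c \<bullet> a - c \<bullet> b"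
  "(- a) \<bullet> c = - (a \<bullet> c)" "c \<bullet> (- a) = - (c \<bullet> a)"
  "0 \<bullet> c = 0" "c \<bullet> 0 = 0"
  "(scale r a) \<bullet> c = scale r (a \<bullet> c)" "c \<bullet> (scale r a) = scale r (c \<bullet> a)"
proof -
  interpret l: Vector_Spaces.linear scale scale "\<lambda>x. x \<bullet> c" by (rule linear_bracket_left)
  interpret r: Vector_Spaces.linear scale scale "\<lambda>x. c \<bullet> x" by (rule linear_bracket_right)
  show "(a + b) \<bullet> c = a \<bullet> c + b \<bullet> c" "c \<bullet> (a + b) = c \<bullet> a + c \<bullet> b"
    "(a - b) \<bullet> c = a \<bullet> c - b \<bullet> c" "c \<bullet> (a - b) = c \<bullet> a - c \<bullet> b"
    "(- a) \<bullet> c = - (a \<bullet> c)" "c \<bullet> (- a) = - (c \<bullet> a)"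
    "0 \<bullet> c = 0" "c \<bullet> 0 = 0"
    "(scale r a) \<bullet> c = scale r (a \<bullet> c)" "c \<bullet> (scale r a) = scale r (c \<bullet> a)"
    by (rule l.add r.add l.diff r.diff l.neg r.neg l.zero r.zero l.scale r.scale)+
qed

lemma bracket_anticomm: "a \<bullet> b = - (b \<bullet> a)"
proof -
  have "a \<bullet> b + b \<bullet> a = (a + b) \<bullet> (a + b)"
    by (simp only: bracket_linear_simps(1,2)) (simp add: bracket_self)
  then show ?thesis
    by (simp only: bracket_self eq_neg_iff_add_eq_0)
qed

lemma bracket_bracket_right: "a \<bullet> (b \<bullet> c) = a \<bullet> b \<bullet> c - a \<bullet> c \<bullet> b"
proof -
  have "b \<bullet> c \<bullet> a = - (a \<bullet> (b \<bullet> c))" "c \<bullet> a \<bullet> b = - (a \<bullet> c \<bullet> b)"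
    using bracket_anticomm[of "b \<bullet> c" a] bracket_anticomm[of c a]
    by (simp_all add: bracket_linear_simps)
  with jacobi[of a b c] show ?thesis
    by (simp add: algebra_simps)
qed

text \<open>The two sides differ by \<open>z \<bullet> (u \<bullet> y)\<close>. Used with u = [yx]
  and u = [yxxx].\<close>

lemma bracket_commute_centralized:
  assumes "u \<bullet> y = 0"
  shows "z \<bullet> u \<bullet> y = z \<bullet> y \<bullet> u"
  using bracket_bracket_right[of z u y] assms by (simp add: bracket_linear_simps)

text \<open>Expand [yx] on both sides of [z,[yx],y] = [z,y,[yx]].\<close>

lemma bracket_x_y_y:
  assumes "y \<bullet> x \<bullet> y = 0"
  shows "z \<bullet> x \<bullet> y \<bullet> y = z \<bullet> y \<bullet> x \<bullet> y + z \<bullet> y \<bullet> x \<bullet> y - z \<bullet> y \<bullet> y \<bullet> x"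
  using bracket_commute_centralized[OF assms, of z]
  by (simp add: bracket_bracket_right bracket_linear_simps algebra_simps)

end

section \<open>Homogeneous components and the choice of \<open>y\<close>\<close>

context thin_lie_algebra
begin

lemma component_scale: "1 \<le> i \<Longrightarrow> v \<in> L i \<Longrightarrow> scale c v \<in> L i"
  using subspace_component subspace_scale by blast

lemma component_diff: "1 \<le> i \<Longrightarrow> v \<in> L i \<Longrightarrow> w \<in> L i \<Longrightarrow> v - w \<in> L i"
  using subspace_component subspace_diff by blast

lemma bracket_L1: "1 \<le> i \<Longrightarrow> z \<in> L i \<Longrightarrow> a \<in> L 1 \<Longrightarrow> z \<bullet> a \<in> L (Suc i)"
  using bracket_component[of i 1 z a] by simp

lemma component_nontrivial:
  assumes "1 \<le> i"
  obtains z where "z \<in> L i" "z \<noteq> 0"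
proof -
  have "dim (L i) = 0" if "L i \<subseteq> {0}"
    using that dim_unique[of "{}" "L i" 0] by (simp add: independent_empty)
  then show ?thesis
    using dim_component[OF assms] that by fastforce
qed

lemma dim_below_second_diamond:
  assumes "1 < i" "i < second_diamond"
  shows "dim (L i) = 1"
  using not_less_Least[of i "\<lambda>k. k > 1 \<and> dim (L k) = 2"] dim_component[of i] assms
  unfolding second_diamond_def by auto

text \<open>For u spanning \<open>L 2\<close>, bracketing with u maps the plane \<open>L 1\<close>
  into the line \<open>L 3\<close>, so it has a nonzero kernel vector \<open>y\<close>, which then
  centralizes all of \<open>L 2\<close>.\<close>

lemma L1_basis_centralizing_L2:
  assumes "dim (L 2) = 1" "dim (L 3) = 1"
  obtains x y where "x \<in> L 1" "y \<in> L 1" "y \<noteq> 0"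
    "\<And>v. v \<in> L 1 \<Longrightarrow> \<exists>\<alpha> \<beta>. v = scale \<alpha> x + scale \<beta> y"
    "\<And>u. u \<in> L 2 \<Longrightarrow> u \<bullet> y = 0"
proof -
  obtain B where B: "B \<subseteq> L 1" "independent B" "L 1 \<subseteq> span B" "card B = 2"
    using basis_exists[of "L 1"] dim_L1 by metis
  then obtain a b where ab: "B = {a, b}" "a \<noteq> b"
    by (auto simp: card_2_iff)
  have mem: "a \<in> L 1" "b \<in> L 1"
    using B(1) ab by auto
  have a0: "a \<noteq> 0" and b_ind: "b \<notin> span {a}"
    using B(2) ab by (auto simp: insert_commute[of a b] independent_insert)
  have comb: "\<exists>\<alpha> \<beta>. v = scale \<alpha> a + scale \<beta> b" if "v \<in> L 1" for v
  proof -
    have "v \<in> span {a, b}" using that B(3) ab by auto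
    then obtain \<alpha> \<beta> where "v - scale \<alpha> a = scale \<beta> b"
      by (auto simp: span_insert span_singleton)
    then show ?thesis by (metis add.commute diff_add_cancel)
  qed
  obtain u where u: "u \<in> L 2" "u \<noteq> 0"
    using component_nontrivial[of 2] by auto
  have L3: "u \<bullet> a \<in> L 3" "u \<bullet> b \<in> L 3"
    using bracket_L1[of 2 u] u mem by (auto simp: numeral_3_eq_3)
  have kill: "u' \<bullet> y = 0" if "u \<bullet> y = 0" and u': "u' \<in> L 2" for u' y
  proof -
    obtain c where "u' = scale c u"
      using dim_1_multiple[OF assms(1) u u'] .
    then show ?thesis using that by (simp add: bracket_linear_simps)
  qed
  show thesis
  proof (cases "u \<bullet> a = 0")
    case True
    show thesis
    proof (rule that[of b a])
      show "\<exists>\<alpha> \<beta>. v = scale \<alpha> b + scale \<beta> a" if "v \<in> L 1" for v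
        using comb[OF that] by (metis add.commute)
    qed (use mem a0 kill True in auto)
  next
    case False
    obtain c where c: "u \<bullet> b = scale c (u \<bullet> a)"
      using dim_1_multiple[OF assms(2) L3(1) False L3(2)] .
    show thesis
    \<comment> \<open>The multiple of \<open>a\<close> is chosen so that the images of
      \<open>b\<close> and \<open>scale c a\<close> under bracketing with \<open>u\<close>
      cancel.\<close>
    proof (rule that[of a "b - scale c a"])
      show "b - scale c a \<in> L 1"
        using mem by (intro component_diff component_scale) auto
      show "b - scale c a \<noteq> 0"
        using b_ind by (auto simp: span_singleton)
      show "u' \<bullet> (b - scale c a) = 0" if "u' \<in> L 2" for u'
        by (rule kill[OF _ that]) (simp add: bracket_linear_simps c)
      fix v assume "v \<in> L 1"
      then obtain \<alpha> \<beta> where "v = scale \<alpha> a + scale \<beta> b"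
        using comb by blast
      then have "v = scale (\<alpha> + \<beta> * c) a + scale \<beta> (b - scale c a)"
        by (simp add: scale_left_distrib scale_right_diff_distrib)
      then show "\<exists>\<alpha> \<beta>. v = scale \<alpha> a + scale \<beta> (b - scale c a)"
        by blast
    qed (use mem in auto)
  qed
qed

end

section \<open>Calculations in a basis of \<open>L 1\<close> adapted to \<open>L 2\<close>\<close>

locale thin_with_basis = thin_lie_algebra scale bracket L
  for scale :: "'f::field \<Rightarrow> 'a::ab_group_add \<Rightarrow> 'a" and bracket L +
  fixes x y :: 'a
  assumes x_mem: "x \<in> L 1" and y_mem: "y \<in> L 1" and y_nonzero: "y \<noteq> 0"
    and L1_span: "v \<in> L 1 \<Longrightarrow> \<exists>\<alpha> \<beta>. v = scale \<alpha> x + scale \<beta> y"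
    and L2_y: "u \<in> L 2 \<Longrightarrow> bracket u y = 0"
begin

lemma bracket_x_mem: "1 \<le> i \<Longrightarrow> z \<in> L i \<Longrightarrow> z \<bullet> x \<in> L (Suc i)"
  and bracket_y_mem: "1 \<le> i \<Longrightarrow> z \<in> L i \<Longrightarrow> z \<bullet> y \<in> L (Suc i)"
  using bracket_L1 x_mem y_mem by blast+

lemma covering_basis:
  assumes "1 \<le> i" "z \<in> L i" "z \<noteq> 0" "v \<in> L (Suc i)"
  obtains \<alpha> \<beta> where "v = scale \<alpha> (z \<bullet> x) + scale \<beta> (z \<bullet> y)"
proof -
  from assms obtain a where a: "a \<in> L 1" "v = z \<bullet> a"
    using covering[OF assms(1-3)] by auto
  with L1_span[OF a(1)] that show ?thesis
    by (auto simp: bracket_linear_simps)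
qed

text \<open>Otherwise covering would make the next component zero. This lets vanishing descend from
  longer products to shorter ones.\<close>

lemma covering_eq_0:
  assumes "1 \<le> i" "z \<in> L i" "z \<bullet> x = 0" "z \<bullet> y = 0"
  shows "z = 0"
proof (rule ccontr)
  assume "z \<noteq> 0"
  obtain v where v: "v \<in> L (Suc i)" "v \<noteq> 0"
    using component_nontrivial[of "Suc i"] by auto
  show False
    by (rule covering_basis[OF assms(1,2) \<open>z \<noteq> 0\<close> v(1)]) (use assms v in simp)
qed

lemma y_x_y: "y \<bullet> x \<bullet> y = 0"
  using L2_y bracket_x_mem[OF _ y_mem] by (simp add: numeral_2_eq_2)

text \<open>Expanding [[yx],[yx]] = 0 gives [yxxy] = [yxyx].\<close>

lemma y_x_x_y: "y \<bullet> x \<bullet> x \<bullet> y = 0"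
  using bracket_bracket_right[of "y \<bullet> x" y x] y_x_y by (simp add: bracket_self bracket_linear_simps)

lemma y_x_x_x_y:
  assumes "(2::'f) \<noteq> 0" and "dim (L 5) = 1"
  shows "y \<bullet> x \<bullet> x \<bullet> x \<bullet> y = 0"
proof (rule ccontr)
  let ?u2 = "y \<bullet> x" and ?u3 = "y \<bullet> x \<bullet> x" and ?u4 = "y \<bullet> x \<bullet> x \<bullet> x"
  let ?w = "?u4 \<bullet> y"
  assume w0: "?w \<noteq> 0"
  have "?u4 \<in> L 4"
    using y_mem by (auto intro!: bracket_x_mem simp: eval_nat_numeral)
  then have w: "?w \<in> L 5" and "?u4 \<bullet> x \<in> L 5"
    using bracket_y_mem[of 4] bracket_x_mem[of 4] by auto
  then obtain c where c: "?u4 \<bullet> x = scale c ?w"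
    using dim_1_multiple[OF assms(2) w w0] by metis
  have wy: "?w \<bullet> y = 0"
    using bracket_x_y_y[OF y_x_y, of ?u3] y_x_x_y by (simp add: bracket_linear_simps)
  have "?u2 \<bullet> ?u3 = ?w"
    using bracket_anticomm[of ?u2 ?u3] bracket_bracket_right[of ?u3 y x] y_x_x_y
    by (simp add: bracket_linear_simps)
  then have "?u2 \<bullet> ?u4 = ?w \<bullet> x"
    using bracket_bracket_right[of ?u2 ?u3 x] by (simp add: bracket_self)
  \<comment> \<open>This second evaluation produces [u4 x y], which vanishes:
    \<open>?u4 \<bullet> x\<close> is a multiple of \<open>?w\<close>, and
    \<open>?w \<bullet> y = 0\<close>.\<close>
  moreover have "?u2 \<bullet> ?u4 = - (?w \<bullet> x)"
    using bracket_anticomm[of ?u2 ?u4] bracket_bracket_right[of ?u4 y x] c wy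
    by (simp add: bracket_linear_simps)
  ultimately have "?w \<bullet> x + ?w \<bullet> x = 0"
    by (metis eq_neg_iff_add_eq_0)
  then have "?w \<bullet> x = 0"
    using double_eq_0_iff[OF assms(1)] by blast
  then show False
    using covering_eq_0[of 5, OF _ w] wy w0 by simp
qed

text \<open>Here \<open>n\<close> is the \<open>i - 4\<close> of the introduction, which avoids truncated subtraction.\<close>

lemma y_y_step:
  assumes two: "(2::'f) \<noteq> 0" and u4: "y \<bullet> x \<bullet> x \<bullet> x \<bullet> y = 0" and "1 \<le> n"
    and below: "\<And>j z. 1 \<le> j \<Longrightarrow> j < n + 4 \<Longrightarrow> z \<in> L j \<Longrightarrow> z \<bullet> y \<bullet> y = 0"
    and "z \<in> L (n + 4)"
  shows "z \<bullet> y \<bullet> y = 0"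
proof (rule ccontr)
  assume nz: "z \<bullet> y \<bullet> y \<noteq> 0"
  note rel = bracket_x_y_y[OF y_x_y]
  note mems = bracket_x_mem bracket_y_mem
  have w_y: "w \<bullet> y \<bullet> y \<bullet> y = 0" and w_x: "w \<bullet> x \<bullet> y \<bullet> y = w \<bullet> y \<bullet> x \<bullet> y + w \<bullet> y \<bullet> x \<bullet> y"
    if "w \<in> L (n + 3)" for w
    using below[of "n + 3", OF _ _ that] rel[of w] by (simp_all add: bracket_linear_simps)
  \<comment> \<open>A nonzero \<open>w\<close> would generate \<open>z\<close> by covering, so (ad
    y)^2 cannot kill both \<open>w \<bullet> x\<close> and \<open>w \<bullet> y\<close>; the latter
    is always killed.\<close>
  have vanish: "w = 0" if w: "w \<in> L (n + 3)" "w \<bullet> x \<bullet> y \<bullet> y = 0" for w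
  proof (rule ccontr)
    assume "w \<noteq> 0"
    moreover have "z \<in> L (Suc (n + 3))"
      using assms(5) by (simp add: numeral_eq_Suc)
    ultimately obtain \<alpha> \<beta> where "z = scale \<alpha> (w \<bullet> x) + scale \<beta> (w \<bullet> y)"
      using covering_basis[OF _ w(1)] by (metis le_add2 le_trans one_le_numeral)
    then show False
      using nz w(2) w_y[OF w(1)] by (simp add: bracket_linear_simps)
  qed
  have y_x: "v \<bullet> y \<bullet> x \<bullet> y \<bullet> y = 0" if "v \<in> L (n + 2)" for v
  proof -
    have "v \<bullet> y \<in> L (n + 3)"
      using bracket_y_mem[OF _ that] by (simp add: numeral_eq_Suc)
    then show ?thesis
      using w_x[of "v \<bullet> y"] below[of "n + 2", OF _ _ that] by (simp add: bracket_linear_simps)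
  qed
  have y_x_x: "t \<bullet> y \<bullet> x \<bullet> x \<bullet> y \<bullet> y = 0" if "t \<in> L (n + 1)" for t
  proof -
    have tx: "t \<bullet> x \<in> L (n + 2)" and "t \<bullet> y \<bullet> x \<in> L (n + 3)"
      using that by (auto intro!: mems simp: numeral_eq_Suc)
    \<comment> \<open>In \<open>rel\<close> at \<open>t\<close> the terms [txyy] and [tyyx] vanish
      by the hypothesis on lower degrees, leaving 2[tyxy] = 0.\<close>
    moreover have "t \<bullet> y \<bullet> x \<bullet> y = 0"
      using rel[of t] below[of "n + 1" t] below[of "n + 2" "t \<bullet> x"] that tx double_eq_0_iff[OF two]
      by (simp add: bracket_linear_simps)
    ultimately show ?thesis
      using w_x[of "t \<bullet> y \<bullet> x"] by (simp add: bracket_linear_simps)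
  qed
  have y_x_x_x: "s \<bullet> y \<bullet> x \<bullet> x \<bullet> x \<bullet> y \<bullet> y = 0" if "s \<in> L n" for s
  proof -
    have "s \<bullet> x \<in> L (n + 1)" "s \<bullet> x \<bullet> x \<in> L (n + 2)" "s \<bullet> x \<bullet> x \<bullet> x \<in> L (n + 3)"
      using that \<open>1 \<le> n\<close> by (auto intro!: mems simp: numeral_eq_Suc)
    note zeros = y_x_x[OF this(1)] y_x[OF this(2)] w_y[OF this(3)]
    \<comment> \<open>Expanding [s,[yxxx]] gives [syxxx] and multiples of [sxyxx], [sxxyx], [sxxxy];
      (ad y)^2 kills the last three by \<open>zeros\<close>.\<close>
    have "s \<bullet> (y \<bullet> x \<bullet> x \<bullet> x) \<bullet> y \<bullet> y = s \<bullet> y \<bullet> y \<bullet> (y \<bullet> x \<bullet> x \<bullet> x)"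
      using bracket_commute_centralized[OF u4] by (simp add: bracket_linear_simps)
    also have "\<dots> = 0"
      using below[of n, OF \<open>1 \<le> n\<close> _ that] by (simp add: bracket_linear_simps)
    finally show ?thesis
      using zeros by (simp add: bracket_bracket_right bracket_linear_simps)
  qed
  obtain s where s: "s \<in> L n" "s \<noteq> 0"
    using component_nontrivial[OF \<open>1 \<le> n\<close>] by auto
  have m: "s \<bullet> x \<in> L (n + 1)" "s \<bullet> y \<in> L (n + 1)" "s \<bullet> x \<bullet> x \<in> L (n + 2)"
    "s \<bullet> x \<bullet> y \<in> L (n + 2)" "s \<bullet> y \<bullet> x \<in> L (n + 2)"
    "s \<bullet> x \<bullet> x \<bullet> x \<in> L (n + 3)" "s \<bullet> x \<bullet> x \<bullet> y \<in> L (n + 3)"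
    "s \<bullet> x \<bullet> y \<bullet> x \<in> L (n + 3)" "s \<bullet> y \<bullet> x \<bullet> x \<in> L (n + 3)" "s \<bullet> y \<bullet> x \<bullet> y \<in> L (n + 3)"
    using s \<open>1 \<le> n\<close> by (auto intro!: mems simp: numeral_eq_Suc)
  have yy: "s \<bullet> y \<bullet> y = 0" "s \<bullet> x \<bullet> y \<bullet> y = 0"
    using below[of n s] below[of "n + 1" "s \<bullet> x"] s m \<open>1 \<le> n\<close> by auto
  \<comment> \<open>Words of length three involving y are treated first, by \<open>vanish\<close> or
    \<open>yy\<close>; \<open>covering_eq_0\<close> then removes the shorter ones.\<close>
  have xxy: "s \<bullet> x \<bullet> x \<bullet> y = 0"
    using vanish[OF m(7)] y_x[OF m(3)] by simp
  have "s \<bullet> x \<bullet> y \<bullet> x = 0"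
    using vanish[OF m(8)] y_x_x[OF m(1)] by simp
  then have xy: "s \<bullet> x \<bullet> y = 0"
    using covering_eq_0[OF _ m(4)] yy by simp
  have "s \<bullet> y \<bullet> x \<bullet> x = 0" "s \<bullet> y \<bullet> x \<bullet> y = 0"
    using vanish[OF m(9)] vanish[OF m(10)] y_x_x_x[OF s(1)] y_x[OF m(5)] by auto
  then have "s \<bullet> y \<bullet> x = 0"
    using covering_eq_0[OF _ m(5)] by simp
  then have y: "s \<bullet> y = 0"
    using covering_eq_0[OF _ m(2)] yy by simp
  let ?w = "s \<bullet> x \<bullet> x \<bullet> x"
  \<comment> \<open>The right side is zero. On the left only the terms 3[wyxy] - [wxyy] survive,
    since [sxy] = [sxxy] = 0. The coefficient 3 here against 2 in \<open>w_x\<close> forces [wyxy] =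
    0 in every characteristic.\<close>
  have "s \<bullet> x \<bullet> (y \<bullet> x \<bullet> x \<bullet> x) \<bullet> y = s \<bullet> x \<bullet> y \<bullet> (y \<bullet> x \<bullet> x \<bullet> x)"
    by (rule bracket_commute_centralized[OF u4])
  then have "?w \<bullet> x \<bullet> y \<bullet> y = ?w \<bullet> y \<bullet> x \<bullet> y + ?w \<bullet> y \<bullet> x \<bullet> y + ?w \<bullet> y \<bullet> x \<bullet> y"
    using xy xxy by (simp add: bracket_bracket_right bracket_linear_simps algebra_simps)
  then have "?w \<bullet> x \<bullet> y \<bullet> y = 0"
    using w_x[OF m(6)] by simp
  \<comment> \<open>The contradiction is reached by descent: w = 0 forces [sxx] = 0, then [sx] = 0,
    then s = 0.\<close>
  then have "?w = 0"
    by (rule vanish[OF m(6)])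
  then have "s \<bullet> x \<bullet> x = 0"
    using covering_eq_0[OF _ m(3)] xxy by simp
  then have "s \<bullet> x = 0"
    using covering_eq_0[OF _ m(1)] xy by simp
  then show False
    using covering_eq_0[OF \<open>1 \<le> n\<close> s(1)] y s(2) by simp
qed

section \<open>Vanishing of (ad y)^2 on each component, then on the whole algebra\<close>

lemma L1_y_y: "v \<in> L 1 \<Longrightarrow> v \<bullet> y \<bullet> y = 0"
  using L2_y bracket_y_mem[of 1] by (simp add: numeral_2_eq_2)

lemma y_y_component_char_2:
  assumes "(2::'f) = 0" and "1 \<le> i" "z \<in> L i"
  shows "z \<bullet> y \<bullet> y = 0"
  using assms(2,3)
proof (induction i arbitrary: z rule: dec_induct)
  case base
  then show ?case by (rule L1_y_y)
next
  case (step i)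
  obtain w where w: "w \<in> L i" "w \<noteq> 0"
    using component_nontrivial step.hyps by auto
  obtain \<alpha> \<beta> where "z = scale \<alpha> (w \<bullet> x) + scale \<beta> (w \<bullet> y)"
    using covering_basis[OF step.hyps(1) w step.prems] .
  then show ?case
    using step.IH[OF w(1)] bracket_x_y_y[OF y_x_y, of w]
    by (simp add: bracket_linear_simps double_eq_0[OF assms(1)])
qed

text \<open>[yx] and [yxx] are nonzero and killed by y, so covering leaves only their brackets with
  x. This settles degrees 3 and 4 of the induction.\<close>

lemma L3_L4_multiples:
  shows "z \<in> L 3 \<Longrightarrow> \<exists>\<alpha>. z = scale \<alpha> (y \<bullet> x \<bullet> x)"
    and "z \<in> L 4 \<Longrightarrow> \<exists>\<alpha>. z = scale \<alpha> (y \<bullet> x \<bullet> x \<bullet> x)"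
proof -
  have u2: "y \<bullet> x \<in> L 2" and u3: "y \<bullet> x \<bullet> x \<in> L 3"
    using y_mem by (auto intro!: bracket_x_mem simp: eval_nat_numeral)
  have "y \<bullet> x \<noteq> 0"
    using covering_eq_0[OF _ y_mem] y_nonzero by (auto simp: bracket_self)
  moreover from this have "y \<bullet> x \<bullet> x \<noteq> 0"
    using covering_eq_0[OF _ u2] y_x_y by auto
  ultimately show "z \<in> L 3 \<Longrightarrow> \<exists>\<alpha>. z = scale \<alpha> (y \<bullet> x \<bullet> x)"
    and "z \<in> L 4 \<Longrightarrow> \<exists>\<alpha>. z = scale \<alpha> (y \<bullet> x \<bullet> x \<bullet> x)"
    using covering_basis[OF _ u2, of z] covering_basis[OF _ u3, of z]
    by (simp_all add: y_x_y y_x_x_y) metis+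
qed

lemma y_y_component:
  assumes "dim (L 5) = 1" "1 \<le> i" "z \<in> L i"
  shows "z \<bullet> y \<bullet> y = 0"
proof (cases "(2::'f) = 0")
  case True
  then show ?thesis using y_y_component_char_2 assms by blast
next
  case False
  note u4 = y_x_x_x_y[OF False assms(1)]
  from assms(2,3) show ?thesis
  proof (induction i arbitrary: z rule: less_induct)
    case (less i)
    \<comment> \<open>\<open>y_y_step\<close> descends to degree i - 4, which must be at least 1, so
      degrees 1 to 4 are base cases.\<close>
    have "i = 1 \<or> i = 2 \<or> i = 3 \<or> i = 4 \<or> (i = (i - 4) + 4 \<and> 1 \<le> i - 4)"
      using less.prems(1) by arith
    then consider "i = 1" | "i = 2" | "i = 3" | "i = 4" | n where "i = n + 4" "1 \<le> n"
      by blast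
    then show ?case
    proof cases
      case 1
      then show ?thesis using L1_y_y less.prems by simp
    next
      case 2
      then show ?thesis using L2_y less.prems by (simp add: bracket_linear_simps)
    next
      case 3
      then show ?thesis
        using L3_L4_multiples(1)[of z] less.prems(2) y_x_x_y by (auto simp: bracket_linear_simps)
    next
      case 4
      then show ?thesis
        using L3_L4_multiples(2)[of z] less.prems(2) u4 by (auto simp: bracket_linear_simps)
    next
      case 5
      then show ?thesis using y_y_step[OF False u4] less by blast
    qed
  qed
qed

lemma y_y_eq_0:
  assumes "dim (L 5) = 1"
  shows "a \<bullet> y \<bullet> y = 0"
proof -
  obtain f where f: "\<And>i. 1 \<le> i \<Longrightarrow> f i \<in> L i" "f 0 = 0" "(\<Sum>i | f i \<noteq> 0. f i) = a"
    using direct_sum[of a] by blast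
  have "f i \<bullet> y \<bullet> y = 0" for i
    using y_y_component[OF assms _ f(1)[of i]] f(2) bracket_linear_simps
    by (cases "i = 0") auto
  \<comment> \<open>Sums over infinite sets are 0 by default, so this holds for every
    \<open>S\<close>.\<close>
  moreover have "(\<Sum>i\<in>S. f i) \<bullet> y \<bullet> y = (\<Sum>i\<in>S. f i \<bullet> y \<bullet> y)" for S
    by (induction S rule: infinite_finite_induct) (simp_all add: bracket_linear_simps)
  ultimately show ?thesis
    unfolding f(3)[symmetric] by simp
qed

end

theorem theorem1:
  fixes scale :: "'f::field \<Rightarrow> 'a::ab_group_add \<Rightarrow> 'a"
    and bracket :: "'a \<Rightarrow> 'a \<Rightarrow> 'a"
    and L :: "nat \<Rightarrow> 'a set"
    and k :: nat
  assumes "thin_lie_algebra scale bracket L"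
    and "k = thin_lie_algebra.second_diamond scale L"
    and "k > 5"
  shows "\<exists>y\<in>L 1. y \<noteq> 0 \<and> (\<forall>a. bracket (bracket a y) y = 0)"
proof -
  interpret thin_lie_algebra scale bracket L by fact
  \<comment> \<open>Degrees 2 and 3 serve to choose \<open>y\<close>; degree 5 serves to show
    [yxxxy] = 0 outside characteristic two.\<close>
  have dims: "dim (L 2) = 1" "dim (L 3) = 1" "dim (L 5) = 1"
    using dim_below_second_diamond assms(2,3) by simp_all
  obtain x y where xy: "x \<in> L 1" "y \<in> L 1" "y \<noteq> 0"
    "\<And>v. v \<in> L 1 \<Longrightarrow> \<exists>\<alpha> \<beta>. v = scale \<alpha> x + scale \<beta> y"
    "\<And>u. u \<in> L 2 \<Longrightarrow> bracket u y = 0"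
    using L1_basis_centralizing_L2[OF dims(1,2)] by metis
  interpret thin_with_basis scale bracket L x y
    by unfold_locales (use xy in auto)
  show ?thesis
    using xy(2,3) y_y_eq_0[OF dims(3)] by blast
qed

end
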